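(* Let $\ell \geq 2$ and let $p^k_{n,\ell}$ denote the number of (strong) independent sets of size $k$ in $P_{n,\ell}$. Then: (a) $p^k_{0,\ell}=1$ if $k=0$ and $p^k_{0,\ell}=0$ if $k>0$; (b) $p^0_{1,\ell}=1$, $p^1_{1,\ell}=\ell$, and $p^k_{1,\ell}=0$ for $k\ge 2$; (c) $p^0_{n,\ell}=1$ for all $n\ge 0$; (d) $p^1_{0,\ell}=0$ and $p^1_{n,\ell}=n\ell-(n-1)$ for $n>0$; (e) for all $n\ge 2$ and $k\ge 2$, $$p^k_{n,\ell}=(\ell-1)^2\sum_{j=0}^{k-2}(\ell-2)^{k-j-2}\binom{k-2}{j}\binom{n-j}{k}.$$ Moreover, for all $n\ge 3$, $k\ge 1$ and $\ell\ge 2$, $$p^k_{n,\ell}=p^k_{n-1,\ell}+p^{k-1}_{n-2,\ell}+(\ell-2)p^{k-1}_{n-1,\ell}.$$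
   Context: A (strong) independent set in a hypergraph is a set of vertices containing at most one vertex from each edge. For $n\ge 1$ and $\ell\ge 2$, $P_{n,\ell}$ is the $\ell$-uniform, $n$-edge linear hyperpath: it has $n$ edges $e_1,\ldots,e_n$ each of size $\ell$, with $e_i$ and $e_{i+1}$ sharing exactly one vertex for each $i<n$, and no other pairs of edges sharing a vertex. $P_{0,\ell}$ is the empty hypergraph (whose only independent set is the empty set). The convention $0^0=1$ is used in the summation formula (relevant when $\ell=2$), and binomial coefficients $\binom{a}{b}$ with $0\le a<b$ are $0$. *)

theory Defs
  imports Main
begin

type_synonym 'a hypergraph = "'a set \<times> 'a set set"

abbreviation verts :: "'a hypergraph \<Rightarrow> 'a set" where
  "verts H \<equiv> fst H"

abbreviation edges :: "'a hypergraph \<Rightarrow> 'a set set" where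
  "edges H \<equiv> snd H"

definition strong_indep :: "'a hypergraph \<Rightarrow> 'a set \<Rightarrow> bool" where
  "strong_indep H S \<longleftrightarrow> S \<subseteq> verts H \<and> (\<forall>e\<in>edges H. card (S \<inter> e) \<le> 1)"

definition num_indep :: "'a hypergraph \<Rightarrow> nat \<Rightarrow> nat" where
  "num_indep H k = card {S. strong_indep H S \<and> card S = k}"

(* There are no isolated vertices, so the case n = 0 is exactly the empty
   hypergraph ({}, {}). For l >= 2 these conditions determine the hypergraph
   up to isomorphism. *)
definition linear_hyperpath :: "nat \<Rightarrow> nat \<Rightarrow> 'a hypergraph \<Rightarrow> bool" where
  "linear_hyperpath l n H \<longleftrightarrow>
     verts H = \<Union>(edges H) \<and>
     (\<exists>e :: nat \<Rightarrow> 'a set.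
        bij_betw e {1..n} (edges H) \<and>
        (\<forall>i\<in>{1..n}. card (e i) = l) \<and>
        (\<forall>i. 1 \<le> i \<and> i < n \<longrightarrow> card (e i \<inter> e (i + 1)) = 1) \<and>
        (\<forall>i\<in>{1..n}. \<forall>j\<in>{1..n}. i + 1 < j \<longrightarrow> e i \<inter> e j = {}))"

(* So a family P with linear_hyperpath l n (P n) for every n exists. *)
lemma linear_hyperpath_exists:
  assumes "l \<ge> 2"
  shows "\<exists>H :: nat hypergraph. linear_hyperpath l n H"
proof -
  define d where "d = l - 1"
  have d: "l = Suc d" "d > 0" using assms by (auto simp: d_def)
  define e :: "nat \<Rightarrow> nat set" where "e i = {(i - 1) * d .. i * d}" for i
  have card_e: "card (e i) = l" if "1 \<le> i" for i
    using that by (cases i) (auto simp: e_def d)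
  have meet: "e i \<inter> e (i + 1) = {i * d}" if "1 \<le> i" for i
    by (auto simp: e_def)
  have less: "i * d < (j - 1) * d" if "i + 1 < j" for i j
    using that d(2) by (intro mult_strict_right_mono) auto
  have disj: "e i \<inter> e j = {}" if "i + 1 < j" for i j
    using less[OF that] by (auto simp: e_def)
  have "inj_on e {1..n}"
  proof (rule linorder_inj_onI)
    fix i j assume ij: "i < j" "i \<in> {1..n}" "j \<in> {1..n}"
    have "(i - 1) * d < (j - 1) * d"
      using ij d(2) by (intro mult_strict_right_mono) auto
    then have "(i - 1) * d \<in> e i" "(i - 1) * d \<notin> e j"
      by (auto simp: e_def)
    then show "e i \<noteq> e j" by blast
  qed auto
  then have "linear_hyperpath l n (\<Union>(e ` {1..n}), e ` {1..n})"
    unfolding linear_hyperpath_def snd_conv fst_conv using card_e meet disj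
    by (intro conjI exI[of _ e]) (simp_all add: bij_betw_def)
  then show ?thesis by blast
qed

end

(* Let a_n^k count the independent k-sets of the path and b_n^k those that avoid a fixed vertex of
   the last edge lying on no other edge (the vertex at which the next edge is glued). An independent
   set of the path with one more edge either misses the l - 1 new vertices, or consists of one new
   vertex and an independent set avoiding the gluing vertex; hence
     a_(n+1)^(k+1) = a_n^(k+1) + (l - 1) b_n^k  and  b_(n+1)^(k+1) = a_n^(k+1) + (l - 2) b_n^k.
   Eliminating b yields the three-term recurrence. The closed formula satisfies the same recurrence,
   by Pascal's rule applied first to the factor C(n - j, k) and then to C(k - 2, j). *)
theory Submission
  imports Defs
begin

section \<open>The numerical recurrence\<close>

(* The argument d stands for l - 2, and the first nat argument for the number of edges minus 1. *)
fun path_count path_avoid :: "nat \<Rightarrow> nat \<Rightarrow> nat \<Rightarrow> nat" where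
  "path_count d 0 k = (if k = 0 then 1 else if k = 1 then d + 2 else 0)"
| "path_avoid d 0 k = (if k = 0 then 1 else if k = 1 then d + 1 else 0)"
| "path_count d (Suc m) 0 = 1"
| "path_avoid d (Suc m) 0 = 1"
| "path_count d (Suc m) (Suc k) = path_count d m (Suc k) + (d + 1) * path_avoid d m k"
| "path_avoid d (Suc m) (Suc k) = path_count d m (Suc k) + d * path_avoid d m k"

lemma path_count_0 [simp]: "path_count d m 0 = 1"
  by (cases m) auto

lemma path_avoid_0 [simp]: "path_avoid d m 0 = 1"
  by (cases m) auto

lemma path_count_1: "path_count d m (Suc 0) = Suc m * (d + 1) + 1"
  by (induction m) auto

text \<open>After one unfolding it remains to see that
  \<open>(d + 1) * path_avoid d (Suc m) k\<close> equals
  \<open>path_count d m k + d * path_count d (Suc m) k\<close>. For positive \<open>k\<close> a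
  second unfolding cancels the remaining \<open>path_avoid\<close> terms; for \<open>k = 0\<close>
  this is \<open>d + 1 = 1 + d\<close>.\<close>

lemma path_count_recurrence:
  "path_count d (Suc (Suc m)) (Suc k) =
     path_count d (Suc m) (Suc k) + path_count d m k + d * path_count d (Suc m) k"
  by (cases k) (auto simp: algebra_simps)

text \<open>The sum in the closed formula without its factor \<open>(l - 1)^2\<close>;
  \<open>K\<close> stands for k - 2, which keeps truncated subtraction out of the recurrences, while
  \<open>n\<close> is the true number of edges.\<close>

definition path_formula :: "nat \<Rightarrow> nat \<Rightarrow> nat \<Rightarrow> nat" where
  "path_formula d n K = (\<Sum>j\<le>K. d ^ (K - j) * (K choose j) * ((n - j) choose (K + 2)))"

lemma path_formula_0 [simp]: "path_formula d n 0 = n choose 2"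
  by (simp add: path_formula_def numeral_2_eq_2)

lemma path_formula_small: "n \<le> K + 1 \<Longrightarrow> path_formula d n K = 0"
  by (auto simp: path_formula_def)

text \<open>Pascal's rule survives truncated subtraction: for \<open>j > Suc n\<close> all three
  upper entries are 0, and \<open>K > 0\<close> excludes \<open>0 choose 0 = 1\<close>.\<close>

lemma pascal_diff:
  assumes "K > 0"
  shows "(Suc (Suc n) - j) choose Suc K = ((Suc n - j) choose Suc K) + ((Suc n - j) choose K)"
proof (cases "j \<le> Suc n")
  case True
  then show ?thesis by (simp add: Suc_diff_le)
next
  case False
  then show ?thesis using assms by simp
qed

lemma path_formula_recurrence:
  "path_formula d (Suc (Suc n)) (Suc K) =
     path_formula d (Suc n) (Suc K) + path_formula d n K + d * path_formula d (Suc n) K"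
proof -
  let ?c = "\<lambda>j. (Suc n - j) choose (K + 2)"
  have "path_formula d (Suc (Suc n)) (Suc K) = path_formula d (Suc n) (Suc K)
      + (\<Sum>j\<le>Suc K. d ^ (Suc K - j) * (Suc K choose j) * ?c j)"
    unfolding path_formula_def sum.distrib[symmetric]
    by (intro sum.cong refl) (simp add: pascal_diff algebra_simps del: binomial_Suc_Suc)
  \<comment> \<open>Pascal's rule for \<open>Suc K choose j\<close> needs a positive lower entry, so
    the term \<open>j = 0\<close> is split off; it later rejoins the half with
    \<open>K choose Suc j\<close>. The other half has upper entries
    \<open>Suc n - Suc j = n - j\<close>.\<close>
  also have "(\<Sum>j\<le>Suc K. d ^ (Suc K - j) * (Suc K choose j) * ?c j) =
      d ^ Suc K * ?c 0 + (\<Sum>j\<le>K. d ^ (K - j) * (Suc K choose Suc j) * ?c (Suc j))"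
    by (subst sum.atMost_Suc_shift) simp
  also have "(\<Sum>j\<le>K. d ^ (K - j) * (Suc K choose Suc j) * ?c (Suc j)) =
      path_formula d n K + (\<Sum>j\<le>K. d ^ (K - j) * (K choose Suc j) * ?c (Suc j))"
    unfolding path_formula_def sum.distrib[symmetric]
    by (intro sum.cong refl) (simp add: algebra_simps)
  also have "d ^ Suc K * ?c 0 + (path_formula d n K + (\<Sum>j\<le>K. d ^ (K - j) * (K choose Suc j) * ?c (Suc j)))
     = path_formula d n K + (\<Sum>j\<le>Suc K. d ^ (Suc K - j) * (K choose j) * ?c j)"
    by (subst sum.atMost_Suc_shift) simp
  \<comment> \<open>The term \<open>j = Suc K\<close> vanishes since
    \<open>K choose Suc K = 0\<close>; in all others one factor \<open>d\<close> comes out.\<close>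
  also have "(\<Sum>j\<le>Suc K. d ^ (Suc K - j) * (K choose j) * ?c j) = d * path_formula d (Suc n) K"
    by (auto simp: path_formula_def sum_distrib_left Suc_diff_le binomial_eq_0 intro!: sum.cong)
  finally show ?thesis by simp
qed

lemma path_count_eq_formula:
  "path_count d m (K + 2) = (d + 1)^2 * path_formula d (Suc m) K"
proof (induction m arbitrary: K rule: induct_nat_012)
  case 0
  show ?case by (simp add: path_formula_small)
next
  case 1
  show ?case
    by (cases K) (simp_all add: path_formula_small numeral_2_eq_2 power2_eq_square)
next
  case (ge2 m)
  show ?case
  proof (cases K)
    \<comment> \<open>Here the recurrence reaches sets of size 1, which the closed formula does not
      cover; the linear count \<open>path_count_1\<close> supplies them.\<close>
    case 0
    then show ?thesis
      using ge2(2)[of 0]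
      by (simp add: path_count_recurrence path_count_1 numeral_2_eq_2 algebra_simps
          del: path_count.simps)
  next
    case (Suc K')
    then show ?thesis
      using ge2(1)[of K'] ge2(2)[of K'] ge2(2)[of K]
      by (simp add: path_count_recurrence path_formula_recurrence algebra_simps
          del: path_count.simps)
  qed
qed

section \<open>Independent sets of a linear hyperpath\<close>

text \<open>The inserted element is the only one outside \<open>V\<close>, so it can be read off
  from the set: insertion is injective and never produces a member of \<open>F\<close>.\<close>

lemma card_Un_insert_image:
  assumes fin: "finite V" and FV: "F \<subseteq> Pow V" and GV: "G \<subseteq> Pow V"
    and X: "finite X" "X \<inter> V = {}"
  shows "card (F \<union> (\<lambda>(x, T). insert x T) ` (X \<times> G)) = card F + card X * card G"
proof -
  have "finite F" "finite G"
    using fin FV GV by (meson finite_Pow_iff finite_subset)+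
  moreover have "inj_on (\<lambda>(x, T). insert x T) (X \<times> G)"
  proof (rule inj_onI, clarify)
    fix x T y U
    assume *: "x \<in> X" "T \<in> G" "y \<in> X" "U \<in> G" "insert x T = insert y U"
    then have "x \<notin> T" "x \<notin> U" "y \<notin> T" "y \<notin> U" using GV X by auto
    then show "x = y \<and> T = U" using *(5) by (metis insert_iff insert_ident)
  qed
  moreover have "F \<inter> (\<lambda>(x, T). insert x T) ` (X \<times> G) = {}"
    using FV X by auto
  ultimately show ?thesis
    using X by (simp add: card_Un_disjoint card_image card_cartesian_product)
qed

section \<open>Prefixes of a linear hyperpath\<close>

locale hyperpath_edges =
  fixes e :: "nat \<Rightarrow> 'a set" and c :: "nat \<Rightarrow> 'a" and l n :: nat
  assumes l: "l \<ge> 2"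
    and card_e: "1 \<le> i \<Longrightarrow> i \<le> n \<Longrightarrow> card (e i) = l"
    and meet: "1 \<le> i \<Longrightarrow> i < n \<Longrightarrow> e i \<inter> e (Suc i) = {c i}"
    and disj: "1 \<le> i \<Longrightarrow> Suc i < j \<Longrightarrow> j \<le> n \<Longrightarrow> e i \<inter> e j = {}"
begin

definition verts_upto :: "nat \<Rightarrow> 'a set" where
  "verts_upto m = \<Union>(e ` {1..m})"

definition indep_upto :: "nat \<Rightarrow> nat \<Rightarrow> 'a set set" where
  "indep_upto m k = {S. S \<subseteq> verts_upto m \<and> (\<forall>i\<in>{1..m}. card (S \<inter> e i) \<le> 1) \<and> card S = k}"

text \<open>\<open>c m\<close> is the vertex at which the next edge is glued. It is specified only
  for \<open>m < n\<close>, whence that bound in the counts below.\<close>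

definition avoid_upto :: "nat \<Rightarrow> nat \<Rightarrow> 'a set set" where
  "avoid_upto m k = {S \<in> indep_upto m k. c m \<notin> S}"

lemma finite_e: "1 \<le> i \<Longrightarrow> i \<le> n \<Longrightarrow> finite (e i)"
  using card_e l by (metis card.infinite not_numeral_le_zero)

lemma finite_V: "m \<le> n \<Longrightarrow> finite (verts_upto m)"
  unfolding verts_upto_def using finite_e by auto

lemma verts_upto_Suc: "verts_upto (Suc m) = verts_upto m \<union> e (Suc m)"
  by (auto simp: verts_upto_def atLeastAtMostSuc_conv)

lemma verts_upto_Int_e: "1 \<le> m \<Longrightarrow> m < n \<Longrightarrow> verts_upto m \<inter> e (Suc m) = {c m}"
proof (rule antisym)
  assume m: "1 \<le> m" "m < n"
  show "verts_upto m \<inter> e (Suc m) \<subseteq> {c m}"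
  proof
    fix x assume "x \<in> verts_upto m \<inter> e (Suc m)"
    then obtain i where i: "1 \<le> i" "i \<le> m" "x \<in> e i" "x \<in> e (Suc m)"
      by (auto simp: verts_upto_def)
    then have "i = m" using disj[of i "Suc m"] m
      by (metis Suc_leI disjoint_iff le_neq_implies_less Suc_less_eq)
    then show "x \<in> {c m}" using i meet m by blast
  qed
  show "{c m} \<subseteq> verts_upto m \<inter> e (Suc m)" using meet[of m] m by (auto simp: verts_upto_def)
qed

lemma c_mem: "1 \<le> m \<Longrightarrow> m < n \<Longrightarrow> c m \<in> e m \<and> c m \<in> e (Suc m)"
  using meet by blast

text \<open>The vertex also lies on edge \<open>Suc (Suc m)\<close>, which is disjoint from the
  first \<open>m\<close> edges.\<close>

lemma c_notin_V: "Suc m < n \<Longrightarrow> c (Suc m) \<notin> verts_upto m"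
  using disj[of _ "Suc (Suc m)"] c_mem[of "Suc m"] by (fastforce simp: verts_upto_def)

lemma indep_upto_Suc:
  assumes m: "1 \<le> m" "m < n"
  shows "indep_upto (Suc m) (Suc k) =
    indep_upto m (Suc k) \<union> (\<lambda>(x, T). insert x T) ` ((e (Suc m) - {c m}) \<times> avoid_upto m k)"
    (is "?L = ?R")
proof (intro antisym subsetI)
  fix S assume S: "S \<in> ?L"
  have SV: "S \<subseteq> verts_upto m \<union> e (Suc m)" and cS: "card S = Suc k"
    and S1: "\<And>i. i \<in> {1..Suc m} \<Longrightarrow> card (S \<inter> e i) \<le> 1"
    using S by (auto simp: indep_upto_def verts_upto_Suc)
  show "S \<in> ?R"
  proof (cases "S \<subseteq> verts_upto m")
    case True
    then show ?thesis using cS S1 by (auto simp: indep_upto_def)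
  next
    case False
    then obtain x where x: "x \<in> S" "x \<notin> verts_upto m" "x \<in> e (Suc m)" using SV by blast
    have fS: "finite S" using cS by (metis card.infinite nat.distinct(1))
    have Sx: "S \<inter> e (Suc m) = {x}"
      using S1[of "Suc m"] x fS by (auto simp: card_le_Suc0_iff_eq)
    have xc: "x \<noteq> c m" using verts_upto_Int_e[OF m] x by auto
    have "card ((S - {x}) \<inter> e i) \<le> 1" if "i \<in> {1..m}" for i
      using S1[of i] that fS
      by (meson Diff_subset Int_mono atLeastAtMost_iff card_mono finite_Int le_SucI order_refl order_trans)
    moreover have "S - {x} \<subseteq> verts_upto m" using SV Sx by blast
    \<comment> \<open>\<open>c m\<close> lies on the last edge, where \<open>x\<close> is the only
      vertex of \<open>S\<close>.\<close>
    moreover have "c m \<notin> S - {x}" using Sx c_mem[OF m] by blast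
    ultimately have "S - {x} \<in> avoid_upto m k" using cS x fS by (simp add: avoid_upto_def indep_upto_def)
    then show ?thesis using x xc
      by (intro UnI2 image_eqI[of _ _ "(x, S - {x})"]) auto
  qed
next
  fix S assume "S \<in> ?R"
  then consider "S \<in> indep_upto m (Suc k)"
    | x T where "x \<in> e (Suc m)" "x \<noteq> c m" "T \<in> avoid_upto m k" "S = insert x T" by auto
  then show "S \<in> ?L"
  proof cases
    case 1
    \<comment> \<open>A set of old vertices can meet the new edge only in \<open>c m\<close>, so the
      new constraint is automatic.\<close>
    then have "card (S \<inter> e (Suc m)) \<le> card {c m}"
      using verts_upto_Int_e[OF m] by (intro card_mono) (auto simp: indep_upto_def)
    then show ?thesis using 1 by (auto simp: indep_upto_def verts_upto_Suc atLeastAtMostSuc_conv)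
  next
    case 2
    then have TV: "T \<subseteq> verts_upto m" and cT: "c m \<notin> T" by (auto simp: avoid_upto_def indep_upto_def)
    have fT: "finite T" using TV finite_V m by (meson finite_subset less_imp_le)
    have xV: "x \<notin> verts_upto m" using 2 verts_upto_Int_e[OF m] by blast
    have "T \<inter> e (Suc m) \<subseteq> {c m}"
      using TV Int_mono[OF TV order_refl, of "e (Suc m)"] by (simp add: verts_upto_Int_e[OF m])
    then have "T \<inter> e (Suc m) = {}" using cT by blast
    then have "S \<inter> e (Suc m) = {x}" using 2(1,4) by blast
    moreover have "S \<inter> e i = T \<inter> e i" if "i \<in> {1..m}" for i
      using that 2(4) xV by (auto simp: verts_upto_def)
    moreover have "card S = Suc k"
      unfolding 2(4) using 2(3) fT TV xV
      by (subst card_insert_disjoint) (auto simp: avoid_upto_def indep_upto_def)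
    moreover have "S \<subseteq> verts_upto (Suc m)" using 2(1,4) TV by (auto simp: verts_upto_Suc)
    ultimately show ?thesis using 2(3) by (simp add: indep_upto_def avoid_upto_def atLeastAtMostSuc_conv)
  qed
qed

text \<open>Infinite sets also have \<open>card\<close> 0; finiteness of the vertex set rules them
  out.\<close>

lemma indep_upto_0: "m \<le> n \<Longrightarrow> indep_upto m 0 = {{}}"
  by (auto simp: indep_upto_def dest: finite_subset[OF _ finite_V])

text \<open>Sets living on the first \<open>m\<close> edges never contain \<open>c (Suc m)\<close>,
  so filtering \<open>indep_upto_Suc\<close> only removes the choice
  \<open>x = c (Suc m)\<close>.\<close>

lemma avoid_upto_Suc:
  assumes m: "1 \<le> m" "Suc m < n"
  shows "avoid_upto (Suc m) (Suc k) =
    indep_upto m (Suc k) \<union> (\<lambda>(x, T). insert x T) ` ((e (Suc m) - {c m, c (Suc m)}) \<times> avoid_upto m k)"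
proof -
  let ?f = "\<lambda>(x, T). insert x T"
  have "c (Suc m) \<notin> S" if "S \<in> indep_upto m j" for S j
    using that c_notin_V[OF m(2)] by (auto simp: indep_upto_def)
  then have not_mem: "{S \<in> indep_upto m (Suc k). c (Suc m) \<notin> S} = indep_upto m (Suc k)"
    and notin_avoid_upto: "T \<in> avoid_upto m k \<Longrightarrow> c (Suc m) \<notin> T" for T by (auto simp: avoid_upto_def)
  have "avoid_upto (Suc m) (Suc k) = {S \<in> indep_upto m (Suc k). c (Suc m) \<notin> S} \<union>
      {S \<in> ?f ` ((e (Suc m) - {c m}) \<times> avoid_upto m k). c (Suc m) \<notin> S}"
    using indep_upto_Suc[of m k] m by (simp add: avoid_upto_def Collect_disj_eq conj_disj_distribR)
  also have "{S \<in> ?f ` ((e (Suc m) - {c m}) \<times> avoid_upto m k). c (Suc m) \<notin> S} =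
      ?f ` ((e (Suc m) - {c m, c (Suc m)}) \<times> avoid_upto m k)"
    using notin_avoid_upto by (fastforce simp: image_iff)
  finally show ?thesis unfolding not_mem .
qed

lemma card_step:
  assumes m: "1 \<le> m" "m < n" and X: "X \<subseteq> e (Suc m) - {c m}"
  shows "card (indep_upto m j \<union> (\<lambda>(x, T). insert x T) ` (X \<times> avoid_upto m k)) =
    card (indep_upto m j) + card X * card (avoid_upto m k)"
proof (rule card_Un_insert_image[of "verts_upto m"])
  show "finite X" using X finite_e[of "Suc m"] m by (auto intro: finite_subset)
  show "X \<inter> verts_upto m = {}" using X verts_upto_Int_e[OF m] by blast
qed (use m in \<open>simp_all add: finite_V indep_upto_def avoid_upto_def Pow_def Collect_mono_iff\<close>)

lemma indep_upto_1: "indep_upto 1 1 = (\<lambda>x. {x}) ` e 1"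
  by (auto simp: indep_upto_def verts_upto_def card_1_singleton_iff)

lemma indep_upto_1_ge2: "k \<ge> 2 \<Longrightarrow> indep_upto 1 k = {}"
  by (auto simp: indep_upto_def verts_upto_def Int_absorb2)

text \<open>Both counts go through one induction because each recurrence for \<open>Suc m\<close>
  calls both functions at \<open>m\<close>.\<close>

lemma card_indep_upto_avoid_upto:
  "Suc m \<le> n \<Longrightarrow> card (indep_upto (Suc m) k) = path_count (l - 2) m k"
  "Suc m < n \<Longrightarrow> card (avoid_upto (Suc m) k) = path_avoid (l - 2) m k"
proof (induction m arbitrary: k)
  case 0
  have l2: "l - 2 + 2 = l" "l - 2 + 1 = l - 1" using l by auto
  {
    case 1
    have "card (indep_upto 1 1) = l" unfolding indep_upto_1 using card_e[of 1] 1 by (simp add: card_image)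
    then show ?case using indep_upto_1_ge2[of k] indep_upto_0[of 1] 1 l2
      by (cases "k = 0"; cases "k = 1") auto
  next
    case 2
    have "avoid_upto 1 1 = (\<lambda>x. {x}) ` (e 1 - {c 1})" unfolding avoid_upto_def indep_upto_1 by auto
    moreover have "card (e 1 - {c 1}) = l - 1"
      using card_e[of 1] c_mem[of 1] 2 by simp
    ultimately have "card (avoid_upto 1 1) = l - 1" by (simp add: card_image)
    moreover have "avoid_upto 1 0 = {{}}" using indep_upto_0[of 1] 2 by (auto simp: avoid_upto_def)
    moreover have "k \<ge> 2 \<Longrightarrow> avoid_upto 1 k = {}" using indep_upto_1_ge2[of k] by (simp add: avoid_upto_def)
    ultimately show ?case using l2 by (cases "k = 0"; cases "k = 1") auto
  }
next
  case (Suc m)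
  {
    case 1
    show ?case
    proof (cases k)
      case 0
      then show ?thesis using indep_upto_0[of "Suc (Suc m)"] 1 by simp
    next
      case (Suc j)
      have "card (e (Suc (Suc m)) - {c (Suc m)}) = l - 2 + 1"
        using card_e[of "Suc (Suc m)"] c_mem[of "Suc m"] 1 l by simp
      then show ?thesis
        using Suc 1 Suc.IH by (simp add: indep_upto_Suc card_step)
    qed
  next
    case 2
    show ?case
    proof (cases k)
      case 0
      have "avoid_upto (Suc (Suc m)) 0 = {{}}" using indep_upto_0[of "Suc (Suc m)"] 2 by (auto simp: avoid_upto_def)
      then show ?thesis using 0 by simp
    next
      case (Suc j)
      \<comment> \<open>The two gluing vertices of this edge differ, the first being old and the
        second new; hence exactly two of its \<open>l\<close> vertices are excluded.\<close>
      have "c (Suc m) \<in> verts_upto (Suc m)" using c_mem[of "Suc m"] 2 by (auto simp: verts_upto_Suc)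
      then have "c (Suc m) \<noteq> c (Suc (Suc m))" using c_notin_V[of "Suc m"] 2 by metis
      then have "card (e (Suc (Suc m)) - {c (Suc m), c (Suc (Suc m))}) = l - 2"
        using card_e[of "Suc (Suc m)"] c_mem[of "Suc m"] c_mem[of "Suc (Suc m)"] 2
        by (simp add: card_Diff_subset)
      then show ?thesis
        using Suc 2 Suc.IH by (subst Suc, subst avoid_upto_Suc) (simp_all add: card_step subset_iff)
    qed
  }
qed

end

section \<open>Transfer to hypergraphs and the final statement\<close>

lemma num_indep_path:
  assumes "l \<ge> 2" "linear_hyperpath l (Suc m) H"
  shows "num_indep H k = path_count (l - 2) m k"
proof -
  from assms(2) obtain e where e: "verts H = \<Union>(edges H)" "bij_betw e {1..Suc m} (edges H)"
    "\<forall>i\<in>{1..Suc m}. card (e i) = l"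
    "\<forall>i. 1 \<le> i \<and> i < Suc m \<longrightarrow> card (e i \<inter> e (i + 1)) = 1"
    "\<forall>i\<in>{1..Suc m}. \<forall>j\<in>{1..Suc m}. i + 1 < j \<longrightarrow> e i \<inter> e j = {}"
    unfolding linear_hyperpath_def by blast
  have E: "edges H = e ` {1..Suc m}" using e(2) by (simp add: bij_betw_def)
  have "\<forall>i. \<exists>x. 1 \<le> i \<and> i < Suc m \<longrightarrow> e i \<inter> e (i + 1) = {x}"
    using e(4) by (meson card_1_singletonE)
  then obtain c where c: "\<And>i. 1 \<le> i \<Longrightarrow> i < Suc m \<Longrightarrow> e i \<inter> e (i + 1) = {c i}"
    by metis
  interpret hyperpath_edges e c l "Suc m"
  proof
    show "l \<ge> 2" by (fact assms(1))
  next
    fix i assume "1 \<le> i" "i \<le> Suc m"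
    then show "card (e i) = l" using e(3) by simp
  next
    fix i assume "1 \<le> i" "i < Suc m"
    then show "e i \<inter> e (Suc i) = {c i}" using c[of i] by simp
  next
    fix i j assume "1 \<le> i" "Suc i < j" "j \<le> Suc m"
    then show "e i \<inter> e j = {}" using e(5)[rule_format, of i j] by simp
  qed
  \<comment> \<open>With no isolated vertices, the prefix of full length has the whole vertex set of
    \<open>H\<close>.\<close>
  have "{S. strong_indep H S \<and> card S = k} = indep_upto (Suc m) k"
    unfolding indep_upto_def verts_upto_def strong_indep_def e(1) E by auto
  then show ?thesis using card_indep_upto_avoid_upto(1)[of m k] by (simp add: num_indep_def)
qed

lemma num_indep_empty:
  assumes "linear_hyperpath l 0 H"
  shows "num_indep H k = (if k = 0 then 1 else 0)"
proof -
  have H: "edges H = {}" "verts H = {}"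
    using assms by (auto simp: linear_hyperpath_def bij_betw_def)
  then have "{S. strong_indep H S \<and> card S = k} = (if k = 0 then {{}} else {})"
    by (auto simp: strong_indep_def)
  then show ?thesis by (simp add: num_indep_def)
qed

theorem theorem1p2:
  fixes l :: nat and P :: "nat \<Rightarrow> 'a hypergraph"
  assumes "l \<ge> 2"
    and "\<And>n. linear_hyperpath l n (P n)"
  shows "(num_indep (P 0) 0 = 1 \<and> (\<forall>k>0. num_indep (P 0) k = 0)) \<and>
    (num_indep (P 1) 0 = 1 \<and> num_indep (P 1) 1 = l \<and> (\<forall>k\<ge>2. num_indep (P 1) k = 0)) \<and>
    (\<forall>n. num_indep (P n) 0 = 1) \<and>
    (num_indep (P 0) 1 = 0 \<and> (\<forall>n>0. num_indep (P n) 1 = n * l - (n - 1))) \<and>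
    (\<forall>n\<ge>2. \<forall>k\<ge>2. num_indep (P n) k =
           (l - 1)^2 * (\<Sum>j=0..k-2. (l - 2)^(k - j - 2) * ((k - 2) choose j) * ((n - j) choose k))) \<and>
    (\<forall>n\<ge>3. \<forall>k\<ge>1. num_indep (P n) k =
           num_indep (P (n - 1)) k + num_indep (P (n - 2)) (k - 1)
             + (l - 2) * num_indep (P (n - 1)) (k - 1))"
proof -
  obtain d where d: "l = d + 2" using assms(1) by (metis add.commute le_Suc_ex)
  have p: "num_indep (P (Suc m)) k = path_count d m k" for m k
    using num_indep_path[OF assms(1) assms(2)] d by simp
  note p0 = num_indep_empty[OF assms(2)]
  have b: "num_indep (P 1) k = path_count d 0 k" for k using p[of 0] by simp
  have c: "num_indep (P n) 0 = 1" for n by (cases n) (simp_all add: p p0)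
  have linear: "num_indep (P n) 1 = n * l - (n - 1)" if n: "n > 0" for n
  proof -
    obtain m where m: "n = Suc m" using n by (cases n) auto
    show ?thesis by (simp add: m p path_count_1 d)
  qed
  have formula: "num_indep (P n) k =
      (l - 1)^2 * (\<Sum>j=0..k-2. (l - 2)^(k - j - 2) * ((k - 2) choose j) * ((n - j) choose k))"
    if n: "n \<ge> 2" and k: "k \<ge> 2" for n k
  proof -
    obtain m where m: "n = Suc m" using n by (cases n) auto
    obtain K where K: "k = K + 2" using k by (metis add.commute le_Suc_ex)
    show ?thesis unfolding m K p path_count_eq_formula
      by (simp add: d path_formula_def atLeast0AtMost)
  qed
  have rec: "num_indep (P n) k = num_indep (P (n - 1)) k + num_indep (P (n - 2)) (k - 1)
      + (l - 2) * num_indep (P (n - 1)) (k - 1)" if n: "n \<ge> 3" and k: "k \<ge> 1" for n k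
  proof -
    \<comment> \<open>Since index 0 of \<open>path_count\<close> is the one-edge path,
      \<open>n \<ge> 3\<close> keeps all three paths within its range.\<close>
    obtain m where m: "n = Suc (Suc (Suc m))" using n by (metis Suc_le_D numeral_3_eq_3 Suc_le_mono)
    obtain K where K: "k = Suc K" using k by (cases k) auto
    show ?thesis using path_count_recurrence[of d m K] by (simp add: m K p d del: path_count.simps)
  qed
  show ?thesis using b c p0 linear formula rec d by simp
qed

end
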